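(* Let $\beta_1,\beta_2,\delta_1,\delta_2\ge 0$ and $\alpha_1,\alpha_2,\gamma_1,\gamma_2>0$ be real, and let $|\sigma|<1$. Let $f=h+\overline{g}\in\hat H$ with $h(z)=z+\sum_{n\ge2}A_nz^n$, $g(z)=\sum_{n\ge1}B_nz^n$. Suppose that (i) $\sum_{n=2}^\infty n|A_n|+\sum_{n=1}^\infty n|B_n|\le 1$ and $|B_1|<1$; (ii) $W_{(\alpha_1,\beta_1),(\gamma_1,\delta_1)}(1)+W_{(\alpha_2,\beta_2),(\gamma_2,\delta_2)}(1)-2\le 1-|B_1|$. Then $L(f)=H+\overline{\sigma G}\in C_{\hat H}$.
   Context: $D=\{z\in\mathbb C:|z|<1\}$. $\hat H$ is the class of complex-valued harmonic functions $f=h+\overline g$ on $D$ with $h,g$ analytic in $D$, $h(z)=z+\sum_{n=2}^\infty A_nz^n$, $g(z)=\sum_{n=1}^\infty B_nz^n$, $|B_1|<1$. $S_{\hat H}$ is the class of sense-preserving univalent functions in $\hat H$. A domain is close-to-convex if its complement can be written as a union of non-crossing half-lines (half-lines with pairwise disjoint relative interiors). $C_{\hat H}$ is the class of $f\in S_{\hat H}$ such that $f(D)$ is close-to-convex. Normalized four-parameter Wright function: for real $a,c>0$ and $b,d\ge0$, $$W_{(a,b),(c,d)}(z)=z+\sum_{n=2}^\infty\frac{\Gamma(a)\Gamma(c)}{\Gamma(a+(n-1)b)\,\Gamma(c+(n-1)d)}z^n .$$ $W(1)$ denotes the sum of this series at $z=1$; a hypothesis involving it is understood to include that it is finite (automatic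 if $b+d>0$). The operator $L$ (depending on $\alpha_i,\beta_i,\gamma_i,\delta_i$, $i=1,2$, and $\sigma$) is $L(f)=H+\overline{\sigma G}$, where $H=h*W_{(\alpha_1,\beta_1),(\gamma_1,\delta_1)}$ and $G=g*W_{(\alpha_2,\beta_2),(\gamma_2,\delta_2)}$; here $*$ is the Hadamard product $\left(\sum a_nz^n\right)*\left(\sum b_nz^n\right)=\sum a_nb_nz^n$. *)

theory Defs
  imports "HOL-Complex_Analysis.Complex_Analysis"
begin

abbreviation unit_disc :: "complex set" where
  "unit_disc \<equiv> ball 0 1"

subsection \<open>Classes of harmonic functions\<close>

text \<open>The values \<open>A 0\<close>, \<open>A 1\<close> and \<open>B 0\<close> play no role. As \<open>g 0 = 0\<close>, the functions \<open>h\<close> and \<open>g\<close>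
  are determined on the disc by \<open>f\<close>.\<close>

definition H_hat_rep ::
  "(complex \<Rightarrow> complex) \<Rightarrow> (complex \<Rightarrow> complex) \<Rightarrow> (complex \<Rightarrow> complex) \<Rightarrow>
   (nat \<Rightarrow> complex) \<Rightarrow> (nat \<Rightarrow> complex) \<Rightarrow> bool" where
  "H_hat_rep f h g A B \<longleftrightarrow>
     h holomorphic_on unit_disc \<and> g holomorphic_on unit_disc \<and>
     (\<forall>z\<in>unit_disc. f z = h z + cnj (g z)) \<and>
     (\<forall>z\<in>unit_disc. (\<lambda>n. A (n + 2) * z ^ (n + 2)) sums (h z - z)) \<and>
     (\<forall>z\<in>unit_disc. (\<lambda>n. B (n + 1) * z ^ (n + 1)) sums g z) \<and>
     norm (B 1) < 1"

definition H_hat :: "(complex \<Rightarrow> complex) set" where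
  "H_hat = {f. \<exists>h g A B. H_hat_rep f h g A B}"

definition jacobian :: "(complex \<Rightarrow> complex) \<Rightarrow> complex \<Rightarrow> real" where
  "jacobian f z =
     (let f' = frechet_derivative f (at z)
      in Re (f' 1) * Im (f' \<i>) - Re (f' \<i>) * Im (f' 1))"

definition sense_preserving_on :: "(complex \<Rightarrow> complex) \<Rightarrow> complex set \<Rightarrow> bool" where
  "sense_preserving_on f S \<longleftrightarrow> (\<forall>z\<in>S. f differentiable (at z) \<and> jacobian f z > 0)"

definition S_hat :: "(complex \<Rightarrow> complex) set" where
  "S_hat = {f \<in> H_hat. inj_on f unit_disc \<and> sense_preserving_on f unit_disc}"

definition half_line :: "complex set \<Rightarrow> bool" where
  "half_line R \<longleftrightarrow> (\<exists>a d. d \<noteq> 0 \<and> R = {a + of_real t * d | t. t \<ge> 0})"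

definition close_to_convex_domain :: "complex set \<Rightarrow> bool" where
  "close_to_convex_domain S \<longleftrightarrow>
     open S \<and> connected S \<and> S \<noteq> {} \<and>
     (\<exists>F. (\<forall>R\<in>F. half_line R) \<and>
          pairwise (\<lambda>R T. disjnt (rel_interior R) (rel_interior T)) F \<and>
          - S = \<Union>F)"

definition C_hat :: "(complex \<Rightarrow> complex) set" where
  "C_hat = {f \<in> S_hat. close_to_convex_domain (f ` unit_disc)}"

subsection \<open>The Wright function and the convolution operator\<close>

definition wright_coeff :: "real \<Rightarrow> real \<Rightarrow> real \<Rightarrow> real \<Rightarrow> nat \<Rightarrow> real" where
  "wright_coeff a b c d n =
     Gamma a * Gamma c / (Gamma (a + real (n - 1) * b) * Gamma (c + real (n - 1) * d))"

text \<open>Polymorphic, so that the value at \<open>1\<close> is available as a real number. If the series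
  diverges at \<open>z\<close>, the value is meaningless.\<close>

definition wright :: "real \<Rightarrow> real \<Rightarrow> real \<Rightarrow> real \<Rightarrow> 'a \<Rightarrow> 'a::{real_normed_field,banach}" where
  "wright a b c d z = z + (\<Sum>n. of_real (wright_coeff a b c d (n + 2)) * z ^ (n + 2))"

definition hadamard :: "(complex \<Rightarrow> complex) \<Rightarrow> (complex \<Rightarrow> complex) \<Rightarrow> complex \<Rightarrow> complex" where
  "hadamard p q z =
     (\<Sum>n. fps_nth (fps_expansion p 0) n * fps_nth (fps_expansion q 0) n * z ^ n)"

text \<open>The operator acts on \<open>f = h + cnj g\<close> through its analytic and co-analytic parts.\<close>

definition wright_op ::
  "real \<Rightarrow> real \<Rightarrow> real \<Rightarrow> real \<Rightarrow> real \<Rightarrow> real \<Rightarrow> real \<Rightarrow> real \<Rightarrow> complex \<Rightarrow>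
   (complex \<Rightarrow> complex) \<Rightarrow> (complex \<Rightarrow> complex) \<Rightarrow> complex \<Rightarrow> complex" where
  "wright_op \<alpha>1 \<beta>1 \<gamma>1 \<delta>1 \<alpha>2 \<beta>2 \<gamma>2 \<delta>2 \<sigma> h g =
     (\<lambda>z. hadamard h (wright \<alpha>1 \<beta>1 \<gamma>1 \<delta>1) z +
          cnj (\<sigma> * hadamard g (wright \<alpha>2 \<beta>2 \<gamma>2 \<delta>2) z))"

end

theory Submission imports Defs begin

text \<open>On the disc the image function is \<open>F z = z + \<phi> z\<close>, and the coefficient hypothesis makes \<open>\<phi>\<close>
  nonexpansive on the closed disc, strictly so when one of the two points is interior. Hence \<open>F\<close> is
  injective. The complement of the image is swept out by the half-lines issuing from \<open>F \<zeta>\<close> in the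
  direction \<open>\<zeta>\<close>, where \<open>\<bar>\<zeta>\<bar> = 1\<close>: with \<open>P\<close> the nearest-point retraction onto the closed disc, they are
  the images of the radial half-lines under \<open>z \<mapsto> z + \<phi> (P z)\<close>, which is onto the plane by Brouwer's
  theorem. Distinct ones do not cross because radial motion outward from the circle strictly
  increases distances.\<close>

section \<open>Half-lines issuing from a perturbed circle\<close>

text \<open>The affine hull is the whole line, so every ball about the endpoint contains points of
  it behind the endpoint; this rules out \<open>t = 0\<close>.\<close>

lemma rel_interior_half_line_subset:
  fixes a d :: complex
  assumes "d \<noteq> 0"
  shows "rel_interior {a + of_real t * d | t. t \<ge> 0} \<subseteq> {a + of_real t * d | t. t > 0}"
proof
  let ?R = "{a + of_real t * d | t. t \<ge> 0}"
  fix x assume x: "x \<in> rel_interior ?R"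
  then obtain e where e: "e > 0" "ball x e \<inter> affine hull ?R \<subseteq> ?R" and "x \<in> ?R"
    using mem_rel_interior_ball by blast
  then obtain t where t: "t \<ge> 0" "x = a + of_real t * d" by blast
  have "t \<noteq> 0"
  proof
    assume "t = 0"
    \<comment> \<open>This puts \<open>a - s d\<close> at distance \<open>e / 2\<close> from the
      endpoint; that point is the affine combination of \<open>a\<close> and \<open>a + d\<close>
      with weights \<open>1 + s\<close> and \<open>- s\<close>.\<close>
    define s where "s = e / (2 * norm d)"
    have s: "s > 0" "s * norm d < e" using e assms by (auto simp: s_def)
    have ad: "a \<in> ?R" "a + d \<in> ?R"
      by (auto intro: exI[of _ 0] exI[of _ 1])
    have "(1 + s) *\<^sub>R a + (- s) *\<^sub>R (a + d) \<in> affine hull ?R"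
      by (rule mem_affine[OF affine_affine_hull hull_inc[OF ad(1)] hull_inc[OF ad(2)]]) simp
    moreover have "(1 + s) *\<^sub>R a + (- s) *\<^sub>R (a + d) = a - of_real s * d"
      by (simp add: scaleR_conv_of_real algebra_simps)
    ultimately have "a - of_real s * d \<in> affine hull ?R" by simp
    moreover have "a - of_real s * d \<in> ball x e"
      using s t \<open>t = 0\<close> by (simp add: dist_norm norm_mult)
    ultimately obtain u where u: "u \<ge> 0" "a - of_real s * d = a + of_real u * d" using e by blast
    then have "of_real (u + s) * d = 0" by (simp add: algebra_simps)
    then have "u + s = 0" using assms by (metis mult_eq_0_iff of_real_eq_0_iff)
    with u s show False by simp
  qed
  with t show "x \<in> {a + of_real t * d | t. t > 0}" by force
qed

text \<open>Expanding squared norms reduces the claim to \<open>z \<bullet> w < 1\<close>. The case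
  \<open>s = 0\<close> admits \<open>w\<close> inside the circle and serves to compare a half-line
  with an image point; the case \<open>norm w = 1\<close> compares two half-lines.\<close>

lemma norm_diff_less_radial:
  fixes z w :: complex
  assumes zw: "norm z = 1" "norm w \<le> 1" "z \<noteq> w" and t: "t > 0" "s \<ge> 0" "norm w = 1 \<or> s = 0"
  shows "norm (z - w) < norm (of_real (1 + t) * z - of_real (1 + s) * w)"
proof -
  have polar: "(norm (of_real u * z - of_real v * w))\<^sup>2 =
      u\<^sup>2 * (norm z)\<^sup>2 + v\<^sup>2 * (norm w)\<^sup>2 - 2 * u * v * (z \<bullet> w)" for u v :: real
    unfolding cmod_power2 by (simp add: inner_complex_def power2_eq_square algebra_simps)
  have ineq: "z \<bullet> w < 1"
  proof -
    have "0 < (norm (z - w))\<^sup>2" using zw by simp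
    also have "\<dots> = 1 + (norm w)\<^sup>2 - 2 * (z \<bullet> w)" using polar[of 1 1] zw by simp
    also have "\<dots> \<le> 2 - 2 * (z \<bullet> w)" using zw by (simp add: power_le_one)
    finally show ?thesis by simp
  qed
  have "(norm (z - w))\<^sup>2 < (norm (of_real (1 + t) * z - of_real (1 + s) * w))\<^sup>2"
  proof (cases "s = 0")
    case True
    have "0 < t\<^sup>2 + 2 * t * (1 - z \<bullet> w)" using ineq t by (simp add: add_pos_pos)
    then show ?thesis using polar[of 1 1] polar[of "1 + t" 1] zw True
      by (simp add: power2_eq_square algebra_simps)
  next
    case False
    \<comment> \<open>The squared norm grows by
      \<open>(t - s)\<^sup>2 + 2 * (t + s + t * s) * (1 - z \<bullet> w)\<close>.\<close>
    have "0 \<le> (t - s)\<^sup>2" "0 < (t + s + t * s) * (1 - z \<bullet> w)"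
      using ineq t by (auto intro!: mult_pos_pos add_pos_nonneg)
    then show ?thesis using polar[of 1 1] polar[of "1 + t" "1 + s"] zw False t
      by (simp add: power2_eq_square algebra_simps)
  qed
  then show ?thesis by (rule power2_less_imp_less) simp
qed

text \<open>A solution is a fixed point of \<open>z \<mapsto> w - \<phi> (P z)\<close>. As
  \<open>P\<close> lands in the closed disc, where \<phi> is bounded by some \<open>M\<close>, this
  map sends \<open>cball w M\<close> into itself.\<close>

lemma id_plus_retract_surj:
  fixes \<phi> :: "complex \<Rightarrow> complex"
  assumes cont: "continuous_on (cball 0 1) \<phi>"
  obtains z where "w = z + \<phi> (z / of_real (max 1 (norm z)))"
proof -
  let ?P = "\<lambda>z::complex. z / of_real (max 1 (norm z))"
  have P: "?P z \<in> cball 0 1" for z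
    by (auto simp: norm_divide divide_simps max_def)
  have "bounded (\<phi> ` cball 0 1)"
    using cont by (intro compact_imp_bounded compact_continuous_image) auto
  then obtain M where M: "M > 0" "\<And>z. z \<in> cball 0 1 \<Longrightarrow> norm (\<phi> z) \<le> M"
    unfolding bounded_pos by blast
  have contP: "continuous_on UNIV (\<lambda>z. \<phi> (?P z))"
  proof (rule continuous_on_compose2[OF cont])
    have "of_real (max 1 (norm z)) \<noteq> (0 :: complex)" for z :: complex
      by (simp only: of_real_eq_0_iff)
    then show "continuous_on UNIV ?P" by (intro continuous_intros continuous_on_max ballI)
  qed (use P in auto)
  obtain z where "w - \<phi> (?P z) = z"
  proof (rule brouwer_ball[of M w "\<lambda>z. w - \<phi> (?P z)"])
    show "continuous_on (cball w M) (\<lambda>z. w - \<phi> (?P z))"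
      by (intro continuous_intros continuous_on_subset[OF contP]) auto
    show "(\<lambda>z. w - \<phi> (?P z)) \<in> cball w M \<rightarrow> cball w M"
      using M P by (auto simp: dist_norm)
  qed (use M in auto)
  then have "w = z + \<phi> (?P z)" by (simp add: algebra_simps)
  with that show thesis .
qed

text \<open>Injectivity, disjointness of the half-lines from the image and their not crossing all
  follow from one clash, \<open>collide\<close>: a coincidence
  \<open>u + \<phi> z = v + \<phi> w\<close> forces \<phi> to spread \<open>z\<close> and
  \<open>w\<close> exactly as far as \<open>u\<close> and \<open>v\<close>.\<close>

lemma nonexpansive_perturbation_close_to_convex:
  fixes \<phi> :: "complex \<Rightarrow> complex"
  assumes le: "\<And>z w. norm z \<le> 1 \<Longrightarrow> norm w \<le> 1 \<Longrightarrow> norm (\<phi> z - \<phi> w) \<le> norm (z - w)"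
    and less: "\<And>z w. norm z \<le> 1 \<Longrightarrow> norm w < 1 \<Longrightarrow> z \<noteq> w \<Longrightarrow> norm (\<phi> z - \<phi> w) < norm (z - w)"
  shows "inj_on (\<lambda>z. z + \<phi> z) unit_disc"
    and "close_to_convex_domain ((\<lambda>z. z + \<phi> z) ` unit_disc)"
proof -
  let ?F = "\<lambda>z. z + \<phi> z"
  have collide: "norm (\<phi> w - \<phi> z) = norm (u - v)" if "u + \<phi> z = v + \<phi> w" for u v z w
  proof -
    have "\<phi> w - \<phi> z = u - v" using that by (simp add: algebra_simps)
    then show ?thesis by simp
  qed
  have cont: "continuous_on (cball 0 1) \<phi>"
    by (rule lipschitz_on_continuous_on[of 1], rule lipschitz_onI) (use le in \<open>auto simp: dist_norm\<close>)
  show inj: "inj_on ?F unit_disc"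
  proof (rule inj_onI)
    fix z w assume "z \<in> unit_disc" "w \<in> unit_disc" "?F z = ?F w"
    then show "z = w" using less[of w z] collide[of z z w w] by (force simp: norm_minus_commute)
  qed
  have contF: "continuous_on unit_disc ?F"
    by (intro continuous_intros continuous_on_subset[OF cont]) auto
  define R where "R = (\<lambda>\<zeta>. {?F \<zeta> + of_real t * \<zeta> | t. t \<ge> 0})"
  have "- (?F ` unit_disc) = \<Union> (R ` sphere 0 1)"
  proof (intro equalityI subsetI)
    fix w assume w: "w \<in> - (?F ` unit_disc)"
    obtain z where z: "w = z + \<phi> (z / of_real (max 1 (norm z)))"
      using id_plus_retract_surj[OF cont] .
    \<comment> \<open>Inside the open disc the retraction is the identity, so a solution there would
      make \<open>w\<close> an image point.\<close>
    have "norm z \<ge> 1"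
    proof (rule ccontr)
      assume "\<not> norm z \<ge> 1"
      then have "w = ?F z" "z \<in> unit_disc" using z by auto
      with w show False by blast
    qed
    define \<zeta> where "\<zeta> = z / of_real (norm z)"
    have "z = of_real (norm z) * \<zeta>" using \<open>norm z \<ge> 1\<close> by (auto simp: \<zeta>_def)
    moreover have "w = z + \<phi> \<zeta>" using z \<open>norm z \<ge> 1\<close> by (simp add: \<zeta>_def)
    ultimately have "w = of_real (norm z) * \<zeta> + \<phi> \<zeta>" by argo
    then have "w = ?F \<zeta> + of_real (norm z - 1) * \<zeta>" by (simp add: algebra_simps)
    then have "w \<in> R \<zeta>" using \<open>norm z \<ge> 1\<close>
      unfolding R_def mem_Collect_eq by (intro exI[of _ "norm z - 1"]) simp
    moreover have "\<zeta> \<in> sphere 0 1" using \<open>norm z \<ge> 1\<close> by (auto simp: \<zeta>_def norm_divide)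
    ultimately show "w \<in> \<Union> (R ` sphere 0 1)" by blast
  next
    fix w assume "w \<in> \<Union> (R ` sphere 0 1)"
    then obtain \<zeta> t where \<zeta>: "norm \<zeta> = 1" "t \<ge> 0" "w = ?F \<zeta> + of_real t * \<zeta>"
      by (auto simp: R_def)
    show "w \<in> - (?F ` unit_disc)"
    proof
      assume "w \<in> ?F ` unit_disc"
      then obtain u where u: "norm u < 1" "w = ?F u" by auto
      have "\<zeta> \<noteq> u" using u \<zeta> by auto
      have "of_real (1 + t) * \<zeta> + \<phi> \<zeta> = u + \<phi> u" using u \<zeta> by (simp add: algebra_simps)
      \<comment> \<open>Meeting at \<open>w\<close> makes the distance from
        \<open>(1 + t) \<zeta>\<close> to \<open>u\<close> equal to that between \<phi> values,
        hence less than \<open>norm (\<zeta> - u)\<close>; but moving \<zeta> outward cannot bring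
        it closer to \<open>u\<close>.\<close>
      from collide[OF this]
      have "norm (of_real (1 + t) * \<zeta> - u) < norm (\<zeta> - u)"
        using less[of \<zeta> u] u \<zeta> \<open>\<zeta> \<noteq> u\<close> by (simp add: norm_minus_commute)
      moreover have "norm (\<zeta> - u) \<le> norm (of_real (1 + t) * \<zeta> - u)"
        using norm_diff_less_radial[of \<zeta> u t 0] u \<zeta> \<open>\<zeta> \<noteq> u\<close> by (cases "t = 0") auto
      ultimately show False by simp
    qed
  qed
  moreover have "pairwise (\<lambda>R T. disjnt (rel_interior R) (rel_interior T)) (R ` sphere 0 1)"
  proof (rule pairwiseI, clarify)
    fix \<zeta> \<xi> assume "\<zeta> \<in> sphere 0 1" "\<xi> \<in> sphere 0 1" and neq: "R \<zeta> \<noteq> R \<xi>"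
    then have n: "norm \<zeta> = 1" "norm \<xi> = 1" "\<zeta> \<noteq> \<xi>" by auto
    have False if x: "x \<in> rel_interior (R \<zeta>)" "x \<in> rel_interior (R \<xi>)" for x
    proof -
      have "\<zeta> \<noteq> 0" "\<xi> \<noteq> 0" using n by auto
      then obtain t s where ts: "t > 0" "x = ?F \<zeta> + of_real t * \<zeta>" "s > 0" "x = ?F \<xi> + of_real s * \<xi>"
        using subsetD[OF rel_interior_half_line_subset x(1)[unfolded R_def]]
          subsetD[OF rel_interior_half_line_subset x(2)[unfolded R_def]]
        unfolding mem_Collect_eq by metis
      \<comment> \<open>Between two points of the circle \<phi> is only nonexpansive, so the strict
        inequality must come from the radial motion; the endpoints themselves are not separated by
        this argument.\<close>
      have "of_real (1 + t) * \<zeta> + \<phi> \<zeta> = of_real (1 + s) * \<xi> + \<phi> \<xi>"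
        using ts by (simp add: algebra_simps)
      from collide[OF this] show False
        using norm_diff_less_radial[of \<zeta> \<xi> t s] le[of \<xi> \<zeta>] n ts by (simp add: norm_minus_commute)
    qed
    then show "disjnt (rel_interior (R \<zeta>)) (rel_interior (R \<xi>))" by (auto simp: disjnt_iff)
  qed
  moreover have "half_line (R \<zeta>)" if "\<zeta> \<in> sphere 0 1" for \<zeta>
    unfolding half_line_def R_def using that by (intro exI[of _ "?F \<zeta>"] exI[of _ \<zeta>]) auto
  moreover have "open (?F ` unit_disc)" using invariance_of_domain[OF contF _ inj] by simp
  moreover have "connected (?F ` unit_disc)" by (intro connected_continuous_image contF) auto
  ultimately show "close_to_convex_domain (?F ` unit_disc)"
    unfolding close_to_convex_domain_def by (intro conjI exI[of _ "R ` sphere 0 1"]) auto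
qed

section \<open>Coefficient bounds\<close>

text \<open>Factor out \<open>z - w\<close>. Of the \<open>n\<close> remaining terms, all but
  \<open>z ^ (n - 1)\<close> contain a factor \<open>w\<close>, so with \<open>r = norm w\<close>
  their sum is at most \<open>(n - 1) r + 1\<close>, which is at most \<open>n (1 + r) / 2\<close>
  once \<open>n \<ge> 2\<close>.\<close>

lemma norm_power_diff_le:
  fixes z w :: "'a::{real_normed_field}"
  assumes "norm z \<le> 1" "norm w \<le> 1" "n \<noteq> 1"
  shows "norm (z ^ n - w ^ n) \<le> real n * ((1 + norm w) / 2) * norm (z - w)"
proof (cases "n = 0")
  case False
  then obtain m where n: "n = Suc (Suc m)" using assms by (metis One_nat_def not0_implies_Suc)
  have term_le: "norm (w ^ (n - Suc i) * z ^ i) \<le> norm w" if "i < Suc m" for i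
  proof -
    have "norm (w ^ (n - Suc i) * z ^ i) \<le> norm w ^ (n - Suc i) * 1"
      unfolding norm_mult norm_power by (intro mult_left_mono power_le_one) (use assms in auto)
    also have "norm w ^ (n - Suc i) \<le> norm w ^ 1"
      by (rule power_decreasing) (use assms that n in auto)
    finally show ?thesis by simp
  qed
  have "norm (\<Sum>i<n. w ^ (n - Suc i) * z ^ i) \<le> (\<Sum>i<n. norm (w ^ (n - Suc i) * z ^ i))"
    by (rule norm_sum)
  also have "\<dots> = (\<Sum>i<Suc m. norm (w ^ (n - Suc i) * z ^ i)) + norm z ^ Suc m"
    by (simp add: n norm_power norm_mult)
  also have "\<dots> \<le> (\<Sum>i<Suc m. norm w) + 1"
    by (intro add_mono sum_mono term_le power_le_one) (use assms in auto)
  also have "\<dots> \<le> real n * ((1 + norm w) / 2)"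
  proof -
    have "real m * norm w \<le> real m * 1" using assms by (intro mult_left_mono) auto
    then show ?thesis by (simp add: n field_simps)
  qed
  finally show ?thesis
    unfolding power_diff_sumr2[of z n w] norm_mult
    by (subst mult.commute) (rule mult_right_mono[OF _ norm_ge_zero])
qed simp

lemma summable_power_series_closed_disc:
  fixes c :: "nat \<Rightarrow> 'a::{real_normed_field,banach}"
  assumes "summable (\<lambda>n. real n * norm (c n))" "norm z \<le> 1"
  shows "summable (\<lambda>n. c n * z ^ n)"
\<comment> \<open>The weight \<open>n\<close> vanishes at \<open>n = 0\<close>, so the comparison
  can only start at 1.\<close>
proof (rule summable_comparison_test_ev[OF _ assms(1)], rule eventually_sequentiallyI[of 1])
  fix n :: nat assume "1 \<le> n"
  have "norm (c n * z ^ n) \<le> norm (c n) * 1"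
    unfolding norm_mult norm_power by (intro mult_left_mono power_le_one) (use assms in auto)
  also have "\<dots> \<le> real n * norm (c n)" using \<open>1 \<le> n\<close> by (simp add: mult_le_cancel_right1)
  finally show "norm (c n * z ^ n) \<le> real n * norm (c n)" .
qed

text \<open>Between a point of the closed disc and one of modulus \<open>r\<close>, every term of degree other than \<open>1\<close>
  gains the factor \<open>(1 + r) / 2\<close>; only the linear term does not contract.\<close>

definition lipschitz_bound :: "(nat \<Rightarrow> 'a::real_normed_vector) \<Rightarrow> real \<Rightarrow> real" where
  "lipschitz_bound c r =
     (1 + r) / 2 * (\<Sum>n. real n * norm (c n)) + (1 - (1 + r) / 2) * norm (c 1)"

lemma power_series_diff_le:
  fixes c :: "nat \<Rightarrow> 'a::{real_normed_field,banach}"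
  assumes c: "summable (\<lambda>n. real n * norm (c n))" and z: "norm z \<le> 1" and w: "norm w \<le> 1"
  shows "norm ((\<Sum>n. c n * z ^ n) - (\<Sum>n. c n * w ^ n)) \<le> lipschitz_bound c (norm w) * norm (z - w)"
proof -
  let ?q = "(1 + norm w) / 2"
  \<comment> \<open>The second summand raises the factor of the linear term from \<open>?q\<close>
    to 1.\<close>
  let ?b = "\<lambda>n. (?q * (real n * norm (c n)) + (if n = 1 then (1 - ?q) * norm (c n) else 0)) * norm (z - w)"
  have sums: "?b sums (lipschitz_bound c (norm w) * norm (z - w))"
    unfolding lipschitz_bound_def
    by (intro sums_mult2 sums_add sums_mult summable_sums c sums_single)
  have "norm (c n * z ^ n - c n * w ^ n) \<le> ?b n" for n
  proof (cases "n = 1")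
    case False
    have "norm (c n) * norm (z ^ n - w ^ n) \<le> norm (c n) * (real n * ?q * norm (z - w))"
      using norm_power_diff_le[OF z w False] by (intro mult_left_mono) auto
    then show ?thesis using False
      by (simp add: right_diff_distrib[symmetric] norm_mult mult_ac)
  next
    case True
    have "?b n = (?q + (1 - ?q)) * norm (c n) * norm (z - w)"
      unfolding distrib_right using True by simp
    also have "\<dots> = norm (c n * z ^ n - c n * w ^ n)"
      by (simp add: True right_diff_distrib[symmetric] norm_mult)
    finally show ?thesis by simp
  qed
  then have "norm (\<Sum>n. c n * z ^ n - c n * w ^ n) \<le> suminf ?b"
    by (intro norm_suminf_le sums_summable[OF sums])
  then show ?thesis
    using sums_unique[OF sums] suminf_diff[OF summable_power_series_closed_disc[OF c z]
        summable_power_series_closed_disc[OF c w]] by simp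
qed

section \<open>Harmonic functions with small coefficients\<close>

lemma holomorphic_power_series_unit_disc:
  fixes c :: "nat \<Rightarrow> complex"
  assumes "summable (\<lambda>n. real n * norm (c n))"
  shows "(\<lambda>z. \<Sum>n. c n * z ^ n) holomorphic_on unit_disc"
  by (rule power_series_holomorphic[where a = c])
    (use summable_power_series_closed_disc[OF assms] in \<open>auto intro!: summable_sums\<close>)

text \<open>Only increments from the fixed point \<open>w\<close> are compared, which suits a
  Lipschitz constant depending on \<open>norm w\<close>.\<close>

lemma norm_deriv_le_local_lipschitz:
  assumes D: "(p has_field_derivative D) (at w)" and S: "open S" "w \<in> S"
    and le: "\<And>z. z \<in> S \<Longrightarrow> norm (p z - p w) \<le> K * norm (z - w)"
  shows "norm D \<le> K"
proof (rule Lim_norm_ubound)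
  show "((\<lambda>z. (p z - p w) / (z - w)) \<longlongrightarrow> D) (at w)" using D by (simp add: has_field_derivative_iff)
  have "eventually (\<lambda>z. z \<in> S) (at w)" using S by (rule eventually_at_in_open')
  moreover have "eventually (\<lambda>z. z \<noteq> w) (at w)" by (simp add: eventually_at_filter)
  ultimately show "eventually (\<lambda>z. norm ((p z - p w) / (z - w)) \<le> K) (at w)"
    by eventually_elim (use le in \<open>auto simp: norm_divide divide_simps\<close>)
qed simp

lemma harmonic_jacobian:
  assumes h: "(h has_field_derivative h') (at z)" and g: "(g has_field_derivative g') (at z)"
    and S: "open S" "z \<in> S" and F: "\<And>w. w \<in> S \<Longrightarrow> F w = h w + cnj (g w)"
  shows "F differentiable (at z)" and "jacobian F z = (norm h')\<^sup>2 - (norm g')\<^sup>2"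
proof -
  have "((\<lambda>w. h w + cnj (g w)) has_derivative (\<lambda>v. h' * v + cnj (g' * v))) (at z)"
    using h g unfolding has_field_derivative_def
    by (intro has_derivative_add bounded_linear.has_derivative[OF bounded_linear_cnj])
  then have D: "(F has_derivative (\<lambda>v. h' * v + cnj (g' * v))) (at z)"
    by (rule has_derivative_transform_within_open[OF _ S]) (simp add: F)
  then show "F differentiable (at z)" by (rule differentiableI)
  have "frechet_derivative F (at z) = (\<lambda>v. h' * v + cnj (g' * v))"
    using frechet_derivative_at[OF D] by simp
  then show "jacobian F z = (norm h')\<^sup>2 - (norm g')\<^sup>2"
    unfolding cmod_power2 by (simp add: jacobian_def Let_def power2_eq_square algebra_simps)
qed

text \<open>With \<open>q = (1 + r) / 2\<close> and \<open>a 1 = 0\<close>, the Lipschitz constants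
  of the two series add up to at most \<open>q + (1 - q) * norm (b 1)\<close>. For
  \<open>r < 1\<close> this is below 1 even when the coefficient sum equals 1, because
  \<open>norm (b 1) < 1\<close>. The same constants bound the derivatives and make the Jacobian
  positive.\<close>

lemma harmonic_in_C_hat:
  fixes a b :: "nat \<Rightarrow> complex"
  assumes a: "summable (\<lambda>n. real n * norm (a n))" "a 0 = 0" "a 1 = 0"
    and b: "summable (\<lambda>n. real n * norm (b n))" "b 0 = 0" "norm (b 1) < 1"
    and le1: "(\<Sum>n. real n * norm (a n)) + (\<Sum>n. real n * norm (b n)) \<le> 1"
    and F: "\<And>z. z \<in> unit_disc \<Longrightarrow> F z = z + (\<Sum>n. a n * z ^ n) + cnj (\<Sum>n. b n * z ^ n)"
  shows "F \<in> C_hat"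
proof -
  define p where "p = (\<lambda>z. \<Sum>n. a n * z ^ n)"
  define g where "g = (\<lambda>z. \<Sum>n. b n * z ^ n)"
  define \<phi> where "\<phi> = (\<lambda>z. p z + cnj (g z))"
  have hol: "p holomorphic_on unit_disc" "g holomorphic_on unit_disc"
    unfolding p_def g_def by (intro holomorphic_power_series_unit_disc a b)+
  have p: "norm (p z - p w) \<le> lipschitz_bound a (norm w) * norm (z - w)"
    and g: "norm (g z - g w) \<le> lipschitz_bound b (norm w) * norm (z - w)"
    if "norm z \<le> 1" "norm w \<le> 1" for z w
    using that power_series_diff_le a(1) b(1) unfolding p_def g_def by blast+
  have bound: "lipschitz_bound a r + lipschitz_bound b r \<le> (1 + r) / 2 + (1 - (1 + r) / 2) * norm (b 1)"
    if "0 \<le> r" for r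
  proof -
    have "(1 + r) / 2 * ((\<Sum>n. real n * norm (a n)) + (\<Sum>n. real n * norm (b n))) \<le> (1 + r) / 2 * 1"
      using le1 that by (intro mult_left_mono) auto
    then show ?thesis using a(3) unfolding lipschitz_bound_def distrib_left by simp
  qed
  have bound_less: "lipschitz_bound a r + lipschitz_bound b r < 1" if r: "0 \<le> r" "r < 1" for r
  proof -
    have "(1 - (1 + r) / 2) * norm (b 1) < (1 - (1 + r) / 2) * 1"
      using b(3) r by (intro mult_strict_left_mono) auto
    with bound[OF r(1)] show ?thesis by simp
  qed
  \<comment> \<open>At \<open>r = 1\<close> the weight of \<open>norm (b 1)\<close> vanishes and the
    bound becomes exactly 1.\<close>
  have bound_le: "lipschitz_bound a r + lipschitz_bound b r \<le> 1" if r: "0 \<le> r" "r \<le> 1" for r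
    using bound_less[OF r(1)] bound[of 1] r by (cases "r = 1") auto
  have \<phi>: "norm (\<phi> z - \<phi> w) \<le> (lipschitz_bound a (norm w) + lipschitz_bound b (norm w)) * norm (z - w)"
    if "norm z \<le> 1" "norm w \<le> 1" for z w
  proof -
    have "\<phi> z - \<phi> w = (p z - p w) + cnj (g z - g w)" by (simp add: \<phi>_def)
    also have "norm \<dots> \<le> norm (p z - p w) + norm (g z - g w)"
      using norm_triangle_ineq complex_mod_cnj by metis
    also have "\<dots> \<le> lipschitz_bound a (norm w) * norm (z - w) + lipschitz_bound b (norm w) * norm (z - w)"
      using p[OF that] g[OF that] by (rule add_mono)
    finally show ?thesis by (simp add: distrib_right)
  qed
  have nonexp: "norm (\<phi> z - \<phi> w) \<le> norm (z - w)" if "norm z \<le> 1" "norm w \<le> 1" for z w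
    using order_trans[OF \<phi>[OF that] mult_right_mono[OF bound_le]] that by simp
  have nonexp_strict: "norm (\<phi> z - \<phi> w) < norm (z - w)" if "norm z \<le> 1" "norm w < 1" "z \<noteq> w" for z w
    using order.strict_trans1[OF \<phi>[of z w] mult_strict_right_mono[OF bound_less]] that by simp
  have Feq: "F z = z + \<phi> z" if "z \<in> unit_disc" for z
    using F[OF that] by (simp add: \<phi>_def p_def g_def)
  have inj: "inj_on F unit_disc"
    using nonexpansive_perturbation_close_to_convex(1)[OF nonexp nonexp_strict] Feq
    by (simp add: inj_on_def)
  have "close_to_convex_domain ((\<lambda>z. z + \<phi> z) ` unit_disc)"
    using nonexpansive_perturbation_close_to_convex(2)[OF nonexp nonexp_strict] .
  also have "(\<lambda>z. z + \<phi> z) ` unit_disc = F ` unit_disc" using Feq by (auto intro!: image_cong)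
  finally have ctc: "close_to_convex_domain (F ` unit_disc)" .
  have "sense_preserving_on F unit_disc"
    unfolding sense_preserving_on_def
  proof
    fix w assume w: "w \<in> unit_disc"
    obtain p' g' where D: "(p has_field_derivative p') (at w)" "(g has_field_derivative g') (at w)"
      using hol w by (meson holomorphic_on_imp_differentiable_at field_differentiable_def open_ball)
    have "norm p' \<le> lipschitz_bound a (norm w)" "norm g' \<le> lipschitz_bound b (norm w)"
      by (rule norm_deriv_le_local_lipschitz[OF _ open_ball w], use D p g w in force,
          use p g w in force)+
    then have "norm p' + norm g' < 1" using bound_less[of "norm w"] w by simp
    moreover have "1 - norm p' \<le> norm (1 + p')"
      using norm_triangle_ineq2[of 1 "- p'"] by simp
    ultimately have "norm g' < norm (1 + p')" by simp
    then have "(norm (1 + p'))\<^sup>2 - (norm g')\<^sup>2 > 0" by (simp add: power_strict_mono)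
    moreover have "((\<lambda>z. z + p z) has_field_derivative 1 + p') (at w)"
      by (intro derivative_intros D)
    note harmonic_jacobian[OF this D(2) open_ball w, of F]
    ultimately show "F differentiable (at w) \<and> jacobian F w > 0"
      using Feq by (simp add: \<phi>_def add.assoc)
  qed
  \<comment> \<open>The linear term of the analytic part is the separate summand \<open>z\<close>,
    so \<open>a\<close> supplies its coefficients from degree 2 on.\<close>
  moreover have "H_hat_rep F (\<lambda>z. z + p z) g a b"
    unfolding H_hat_rep_def
  proof (intro conjI ballI)
    fix z :: complex assume z: "z \<in> unit_disc"
    have "(\<lambda>n. a n * z ^ n) sums p z" "(\<lambda>n. b n * z ^ n) sums g z"
      unfolding p_def g_def
      by (intro summable_sums summable_power_series_closed_disc a b; use z in simp)+
    then show "(\<lambda>n. a (n + 2) * z ^ (n + 2)) sums (z + p z - z)"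
      "(\<lambda>n. b (n + 1) * z ^ (n + 1)) sums g z"
      using sums_iff_shift[of "\<lambda>n. a n * z ^ n" 2 "p z"] sums_iff_shift[of "\<lambda>n. b n * z ^ n" 1 "g z"]
        a b by (simp_all add: numeral_2_eq_2)
    show "F z = z + p z + cnj (g z)" using Feq[OF z] by (simp add: \<phi>_def)
  qed (use hol b in \<open>auto intro!: holomorphic_intros\<close>)
  ultimately show ?thesis using inj ctc unfolding C_hat_def S_hat_def H_hat_def by blast
qed

section \<open>Hadamard products and the Wright function\<close>

text \<open>By uniqueness of Taylor coefficients, Hadamard products can be computed from any power
  series representation; convergence at \<open>1 / 2\<close> already gives a positive
  radius.\<close>

lemma fps_expansion_power_series:
  assumes "\<And>z. z \<in> unit_disc \<Longrightarrow> (\<lambda>n. c n * z ^ n) sums p z"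
  shows "fps_expansion p 0 = Abs_fps c"
proof (rule fps_expansion_eqI)
  have "conv_radius c \<ge> norm (1 / 2 :: complex)"
    by (rule conv_radius_geI) (use assms[of "1 / 2"] sums_summable in auto)
  then have "conv_radius c > 0" by (rule less_le_trans[rotated]) (simp add: zero_ereal_def)
  moreover have "eventually (\<lambda>z. z \<in> unit_disc) (nhds (0 :: complex))"
    by (rule eventually_nhds_in_open) auto
  then have "eventually (\<lambda>z. eval_fps (Abs_fps c) z = p z) (nhds 0)"
    by eventually_elim (simp add: eval_fps_def sums_unique[OF assms, symmetric])
  ultimately show "p has_fps_expansion Abs_fps c"
    by (simp add: has_fps_expansion_def fps_conv_radius_def)
qed

lemma hadamard_power_series:
  assumes "\<And>z. z \<in> unit_disc \<Longrightarrow> (\<lambda>n. c n * z ^ n) sums p z"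
    and "\<And>z. z \<in> unit_disc \<Longrightarrow> (\<lambda>n. d n * z ^ n) sums q z"
  shows "hadamard p q z = (\<Sum>n. c n * d n * z ^ n)"
  using fps_expansion_power_series[of c p] fps_expansion_power_series[of d q] assms
  by (simp add: hadamard_def)

lemma wright_coeff_pos:
  assumes "a > 0" "b \<ge> 0" "c > 0" "d \<ge> 0"
  shows "wright_coeff a b c d n > 0"
  using assms by (auto simp: wright_coeff_def intro!: divide_pos_pos mult_pos_pos Gamma_real_pos add_pos_nonneg)

lemma wright_coeff_1:
  assumes "a > 0" "c > 0"
  shows "wright_coeff a b c d 1 = 1"
  using Gamma_real_pos[OF assms(1)] Gamma_real_pos[OF assms(2)] by (simp add: wright_coeff_def)

text \<open>The index 0 is masked because natural subtraction makes \<open>wright_coeff\<close> take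
  the value 1 there, not 0.\<close>

lemma wright_sums:
  fixes z :: complex
  assumes "a > 0" "b \<ge> 0" "c > 0" "d \<ge> 0"
    and sm: "summable (\<lambda>n. wright_coeff a b c d (n + 2))" and z: "norm z \<le> 1"
  shows "(\<lambda>n. (if n = 0 then 0 else of_real (wright_coeff a b c d n)) * z ^ n) sums wright a b c d z"
proof -
  have "summable (\<lambda>n. of_real (wright_coeff a b c d (n + 2)) * z ^ (n + 2))"
  proof (rule summable_comparison_test'[OF sm])
    fix n
    have "wright_coeff a b c d (n + 2) * norm z ^ (n + 2) \<le> wright_coeff a b c d (n + 2) * 1"
      by (intro mult_left_mono power_le_one) (use z wright_coeff_pos[of a b c d] assms in \<open>auto simp: less_imp_le\<close>)
    then show "norm (of_real (wright_coeff a b c d (n + 2)) * z ^ (n + 2)) \<le> wright_coeff a b c d (n + 2)"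
      using wright_coeff_pos[of a b c d "n + 2"] assms by (simp add: norm_mult norm_power)
  qed
  then have "(\<lambda>n. of_real (wright_coeff a b c d (n + 2)) * z ^ (n + 2)) sums (wright a b c d z - z)"
    by (auto simp: wright_def dest: summable_sums)
  then show ?thesis
    using wright_coeff_1[of a c b d] assms
      sums_iff_shift[of "\<lambda>n. (if n = 0 then 0 else of_real (wright_coeff a b c d n)) * z ^ n" 2
        "wright a b c d z - z"]
    by (simp add: numeral_2_eq_2)
qed

text \<open>No term of a nonnegative series exceeds its sum, so each \<open>x n\<close> is at most
  1. This lets the Wright coefficients alone dominate the convolved coefficient sum.\<close>

lemma weighted_sum_le:
  fixes x w :: "nat \<Rightarrow> real"
  assumes x: "summable x" "\<And>n. x n \<ge> 0" "suminf x \<le> 1" and w: "summable w" "\<And>n. w n \<ge> 0"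
  shows "summable (\<lambda>n. x n * w n)" and "(\<Sum>n. x n * w n) \<le> suminf w"
proof -
  have "x n \<le> 1" for n
    using sum_le_suminf[OF x(1), of "{n}"] x by auto
  then have le: "x n * w n \<le> w n" for n using w(2)[of n] by (simp add: mult_left_le_one_le x)
  show "summable (\<lambda>n. x n * w n)"
    by (rule summable_comparison_test'[OF w(1)]) (use le x w in simp)
  then show "(\<Sum>n. x n * w n) \<le> suminf w" by (intro suminf_le le w)
qed

text \<open>The summability assumptions express convergence of the sums in (i) and finiteness of
  \<open>W(1)\<close> in (ii), since \<open>suminf\<close> is total.\<close>

theorem theorem7:
  fixes \<alpha>1 \<beta>1 \<gamma>1 \<delta>1 \<alpha>2 \<beta>2 \<gamma>2 \<delta>2 :: real and \<sigma> :: complex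
    and f h g :: "complex \<Rightarrow> complex" and A B :: "nat \<Rightarrow> complex"
  assumes "\<beta>1 \<ge> 0" "\<beta>2 \<ge> 0" "\<delta>1 \<ge> 0" "\<delta>2 \<ge> 0"
    and "\<alpha>1 > 0" "\<alpha>2 > 0" "\<gamma>1 > 0" "\<gamma>2 > 0"
    and "norm \<sigma> < 1"
    and "H_hat_rep f h g A B"
    and "summable (\<lambda>n. real (n + 2) * norm (A (n + 2)))"
    and "summable (\<lambda>n. real (n + 1) * norm (B (n + 1)))"
    and "(\<Sum>n. real (n + 2) * norm (A (n + 2))) + (\<Sum>n. real (n + 1) * norm (B (n + 1))) \<le> 1"
    and "norm (B 1) < 1"
    and "summable (\<lambda>n. wright_coeff \<alpha>1 \<beta>1 \<gamma>1 \<delta>1 (n + 2))"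
    and "summable (\<lambda>n. wright_coeff \<alpha>2 \<beta>2 \<gamma>2 \<delta>2 (n + 2))"
    and "wright \<alpha>1 \<beta>1 \<gamma>1 \<delta>1 1 + wright \<alpha>2 \<beta>2 \<gamma>2 \<delta>2 1 - 2 \<le> 1 - norm (B 1)"
  shows "wright_op \<alpha>1 \<beta>1 \<gamma>1 \<delta>1 \<alpha>2 \<beta>2 \<gamma>2 \<delta>2 \<sigma> h g \<in> C_hat"
proof -
  let ?w1 = "wright_coeff \<alpha>1 \<beta>1 \<gamma>1 \<delta>1" and ?w2 = "wright_coeff \<alpha>2 \<beta>2 \<gamma>2 \<delta>2"
  have w1: "?w1 n > 0" and w2: "?w2 n > 0" for n using wright_coeff_pos assms by auto
  \<comment> \<open>\<open>a\<close> holds the coefficients of \<open>H\<close> beyond its linear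
    term \<open>z\<close>, and \<open>b\<close> those of \<open>\<sigma> * G\<close>.\<close>
  define a where "a n = (if n < 2 then 0 else A n * of_real (?w1 n))" for n
  define b where "b n = (if n = 0 then 0 else \<sigma> * B n * of_real (?w2 n))" for n
  \<comment> \<open>Both sequences start at degree 2, like the coefficients summed in
    \<open>W(1) - 1\<close>; the term \<open>norm (B 1)\<close> is split off because its Wright
    coefficient is 1.\<close>
  define x where "x n = real (n + 2) * norm (A (n + 2))" for n
  define y where "y n = real (n + 2) * norm (B (n + 2))" for n
  have x: "summable x" "\<And>n. x n \<ge> 0" using assms unfolding x_def by auto
  have y': "summable (\<lambda>n. real (n + 1) * norm (B (n + 1)))" using assms by simp
  have y: "summable y" "\<And>n. y n \<ge> 0"
    using summable_Suc_iff[THEN iffD2, OF y'] unfolding y_def by (auto simp: add_ac)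
  have "(\<Sum>n. real (n + 1) * norm (B (n + 1))) = norm (B 1) + suminf y"
    using suminf_split_head[OF y'] unfolding y_def by (simp add: add_ac)
  then have "suminf x + suminf y + norm (B 1) \<le> 1" using assms unfolding x_def by simp
  moreover have "0 \<le> suminf x" "0 \<le> suminf y" using x y suminf_nonneg by auto
  ultimately have xy: "suminf x \<le> 1" "suminf y \<le> 1" using norm_ge_zero[of "B 1"] by linarith+
  note xw = weighted_sum_le[OF x xy(1) _ less_imp_le[OF w1], of "\<lambda>n. n + 2"]
  note yw = weighted_sum_le[OF y xy(2) _ less_imp_le[OF w2], of "\<lambda>n. n + 2"]
  have a_sums: "(\<lambda>n. real n * norm (a n)) sums (\<Sum>n. x n * ?w1 (n + 2))"
  proof -
    have "(\<lambda>n. real (n + 2) * norm (a (n + 2))) = (\<lambda>n. x n * ?w1 (n + 2))"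
      using w1 by (auto simp: a_def x_def norm_mult less_imp_le)
    then show ?thesis
      using summable_sums[OF xw(1)] assms
        sums_iff_shift[of "\<lambda>n. real n * norm (a n)" 2 "\<Sum>n. x n * ?w1 (n + 2)"]
      by (simp add: numeral_2_eq_2 a_def)
  qed
  have b_sums: "(\<lambda>n. real n * norm (b n)) sums (norm \<sigma> * (norm (B 1) + (\<Sum>n. y n * ?w2 (n + 2))))"
  proof -
    have "(\<lambda>n. real (n + 2) * norm (b (n + 2))) = (\<lambda>n. norm \<sigma> * (y n * ?w2 (n + 2)))"
      using w2 by (auto simp: b_def y_def norm_mult less_imp_le)
    moreover have "b 1 = \<sigma> * B 1" using wright_coeff_1[of \<alpha>2 \<gamma>2 \<beta>2 \<delta>2] assms by (simp add: b_def)
    ultimately show ?thesis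
      using sums_mult[OF summable_sums[OF yw(1)], of "norm \<sigma>"] assms
        sums_iff_shift[of "\<lambda>n. real n * norm (b n)" 2 "norm \<sigma> * (\<Sum>n. y n * ?w2 (n + 2))"]
      by (simp add: numeral_2_eq_2 distrib_left norm_mult add.commute)
  qed
  show ?thesis
  proof (rule harmonic_in_C_hat[of a b])
    show "norm (b 1) < 1"
      using wright_coeff_1[of \<alpha>2 \<gamma>2 \<beta>2 \<delta>2] assms mult_strict_mono'[of "norm \<sigma>" 1 "norm (B 1)" 1]
      by (simp add: b_def norm_mult)
    have "norm \<sigma> * (norm (B 1) + (\<Sum>n. y n * ?w2 (n + 2))) \<le> norm (B 1) + (\<Sum>n. y n * ?w2 (n + 2))"
      using assms y w2 yw(1)
      by (intro mult_left_le_one_le add_nonneg_nonneg suminf_nonneg) (auto simp: less_imp_le)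
    \<comment> \<open>This is (ii): the slack \<open>1 - norm (B 1)\<close> is what the linear term
      of \<open>G\<close> consumes in the bound just above.\<close>
    moreover have "(\<Sum>n. ?w1 (n + 2)) + (\<Sum>n. ?w2 (n + 2)) \<le> 1 - norm (B 1)"
      using assms by (simp add: wright_def)
    ultimately show "(\<Sum>n. real n * norm (a n)) + (\<Sum>n. real n * norm (b n)) \<le> 1"
      using xw(2) yw(2) assms sums_unique[OF a_sums] sums_unique[OF b_sums] by simp
  next
    fix z assume z: "z \<in> unit_disc"
    \<comment> \<open>\<open>c\<close> and \<open>d\<close> are the full Taylor sequences of
      \<open>h\<close> and \<open>g\<close>, with the low-degree entries set to their true
      values.\<close>
    define c where "c n = (if n = 0 then 0 else if n = 1 then 1 else A n)" for n
    define d where "d n = (if n = 0 then 0 else B n)" for n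
    have c: "(\<lambda>n. c n * u ^ n) sums h u" and d: "(\<lambda>n. d n * u ^ n) sums g u"
      if "u \<in> unit_disc" for u
      using that assms sums_iff_shift[of "\<lambda>n. c n * u ^ n" 2 "h u - u"]
        sums_iff_shift[of "\<lambda>n. d n * u ^ n" 1 "g u"]
      by (auto simp: H_hat_rep_def numeral_2_eq_2 c_def d_def)
    have "(\<lambda>n. a n * z ^ n) sums (\<Sum>n. a n * z ^ n)"
      by (intro summable_sums summable_power_series_closed_disc sums_summable[OF a_sums])
        (use z in simp)
    then have "(\<lambda>n. (if n = 1 then z ^ n else 0) + a n * z ^ n) sums (z ^ 1 + (\<Sum>n. a n * z ^ n))"
      by (intro sums_add sums_single)
    moreover have "(if n = 1 then z ^ n else 0) + a n * z ^ n =
        c n * (if n = 0 then 0 else of_real (?w1 n)) * z ^ n" for n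
      using wright_coeff_1[of \<alpha>1 \<gamma>1 \<beta>1 \<delta>1] assms by (auto simp: a_def c_def less_2_cases_iff)
    ultimately have H: "hadamard h (wright \<alpha>1 \<beta>1 \<gamma>1 \<delta>1) z = z + (\<Sum>n. a n * z ^ n)"
      using hadamard_power_series[OF c wright_sums[of \<alpha>1 \<beta>1 \<gamma>1 \<delta>1]] assms
      by (simp add: sums_unique[symmetric])
    let ?e = "\<lambda>n. d n * (if n = 0 then 0 else of_real (?w2 n)) * z ^ n"
    have "\<sigma> * hadamard g (wright \<alpha>2 \<beta>2 \<gamma>2 \<delta>2) z = (\<Sum>n. b n * z ^ n)"
    \<comment> \<open>Summability of \<open>?e\<close> is recovered from that of the
      \<open>b\<close> series by cancelling \<sigma>; for \<open>\<sigma> = 0\<close> both sides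
      vanish.\<close>
    proof (cases "\<sigma> = 0")
      case False
      have "(\<lambda>n. b n * z ^ n) = (\<lambda>n. \<sigma> * ?e n)" by (auto simp: b_def d_def)
      moreover have "summable (\<lambda>n. b n * z ^ n)"
        by (intro summable_power_series_closed_disc sums_summable[OF b_sums]) (use z in simp)
      ultimately have "(\<Sum>n. b n * z ^ n) = \<sigma> * (\<Sum>n. ?e n)"
        using False summable_mult_D[of \<sigma> ?e] suminf_mult[of ?e \<sigma>] by metis
      then show ?thesis
        using hadamard_power_series[OF d wright_sums[of \<alpha>2 \<beta>2 \<gamma>2 \<delta>2]] assms by simp
    next
      case True
      then have "b = (\<lambda>_. 0)" by (auto simp: b_def)
      with True show ?thesis by simp
    qed
    with H show "wright_op \<alpha>1 \<beta>1 \<gamma>1 \<delta>1 \<alpha>2 \<beta>2 \<gamma>2 \<delta>2 \<sigma> h g z =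
        z + (\<Sum>n. a n * z ^ n) + cnj (\<Sum>n. b n * z ^ n)"
      by (simp add: wright_op_def del: complex_cnj_mult)
  qed (use sums_summable[OF a_sums] sums_summable[OF b_sums] in \<open>auto simp: a_def b_def\<close>)
qed

end
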